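(* Let $\mathbb{E}$ be a (finite-dimensional) Euclidean space, let $f\in\Gamma_0(\mathbb{E})$ and fix $\bar x\in\mathbb{E}$. Define $\bar\phi:\mathbb{R}\to\mathbb{R}\cup\{+\infty\}$ by $$\bar\phi(\lambda)=\begin{cases}-\lambda e_\lambda f(\bar x)&\text{if }\lambda>0,\\-\frac12d^2_{\mathrm{cl}(\mathrm{dom} f)}(\bar x)&\text{if }\lambda=0,\\-\lambda f(P_{\mathrm{cl}(\mathrm{dom} f)}(\bar x))-\frac12d^2_{\mathrm{cl}(\mathrm{dom} f)}(\bar x)&\text{if }\lambda<0.\end{cases}$$ Then the following hold: (a) $\bar\phi$ is proper, convex and continuous (possibly in an extended real-valued sense), and continuously differentiable on $\mathbb{R}_{++}$ with $\frac{d}{d\lambda}\bar\phi(\lambda)=-f(P_\lambda f(\bar x))$ locally Lipschitz for all $\lambda>0$. (b) If $\bar x\in\mathrm{dom} f$, then $\bar\phi$ is continuously differentiable on $\mathbb{R}$ with derivative $$\frac{d}{d\lambda}\bar\phi(\lambda)=\begin{cases}-f(P_\lambda f(\bar x))&\text{if }\lambda>0,\\-f(P_{\mathrm{cl}(\mathrm{dom} f)}(\bar x))&\text{if }\lambda\le0.\end{cases}$$ If, more strictly, $\bar x\in\mathrm{dom}\,\partial f$, then this derivative is locally Lipschitz on all of $\mathbb{R}$. (c) If $P_{\mathrm{cl}(\mathrm{dom} f)}(\bar x)\notin\mathrm{dom} f$, then $\mathrm{dom}\,\bar\phi=\mathbb{R}_+$ and $$\partial\bar\phi(\lambda)=\begin{cases}\{-f(P_\lambda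 f(\bar x))\}&\text{if }\lambda>0,\\\emptyset&\text{if }\lambda\le0.\end{cases}$$
   Context: $\Gamma_0(\mathbb{E})$ denotes the closed proper convex functions $\mathbb{E}\to\mathbb{R}\cup\{+\infty\}$. For $\lambda>0$, $e_\lambda f(x)=\min_u\{f(u)+\frac1{2\lambda}\|x-u\|^2\}$ and $P_\lambda f(x)$ is the unique minimizer. $P_C$ and $d_C$ are the Euclidean projection onto and distance to a closed convex set $C$. $\partial$ is the convex subdifferential; $\mathrm{dom}\,\partial f=\{x\mid\partial f(x)\neq\emptyset\}$; $\mathbb{R}_+=[0,\infty)$, $\mathbb{R}_{++}=(0,\infty)$.
   Formalization: In (a), "continuous" is read as lower semicontinuous on ℝ and continuous relative to dom φ̄: when P_{cl(dom f)}(x̄) ∉ dom f, φ̄ jumps from +∞ to a finite value at λ=0 (e.g. f=−log, x̄=0), so extended-real continuity at 0 fails. *)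

theory Defs
  imports "HOL-Analysis.Analysis"
begin

definition edom :: "('a \<Rightarrow> ereal) \<Rightarrow> 'a set" where
  "edom f = {x. f x < \<infinity>}"

definition eepi :: "('a \<Rightarrow> ereal) \<Rightarrow> ('a \<times> real) set" where
  "eepi f = {(x, r). f x \<le> ereal r}"

definition proper_fun :: "('a \<Rightarrow> ereal) \<Rightarrow> bool" where
  "proper_fun f \<longleftrightarrow> (\<forall>x. f x \<noteq> -\<infinity>) \<and> (\<exists>x. f x \<noteq> \<infinity>)"

definition convex_fun :: "('a::real_vector \<Rightarrow> ereal) \<Rightarrow> bool" where
  "convex_fun f \<longleftrightarrow> convex (eepi f)"

text \<open>For extended real-valued functions, closedness is lower semicontinuity on the
  whole space.\<close>

definition closed_fun :: "('a::topological_space \<Rightarrow> ereal) \<Rightarrow> bool" where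
  "closed_fun f \<longleftrightarrow> closed (eepi f)"

definition Gamma0 :: "('a::euclidean_space \<Rightarrow> ereal) set" where
  "Gamma0 = {f. closed_fun f \<and> proper_fun f \<and> convex_fun f}"

text \<open>At a point outside the domain of a proper function, the subdifferential is empty.\<close>

definition subdiff :: "('a::real_inner \<Rightarrow> ereal) \<Rightarrow> 'a \<Rightarrow> 'a set" where
  "subdiff f x = {v. \<forall>y. f y \<ge> f x + ereal (inner v (y - x))}"

definition dom_subdiff :: "('a::real_inner \<Rightarrow> ereal) \<Rightarrow> 'a set" where
  "dom_subdiff f = {x. subdiff f x \<noteq> {}}"

definition prox_obj :: "real \<Rightarrow> ('a::real_inner \<Rightarrow> ereal) \<Rightarrow> 'a \<Rightarrow> 'a \<Rightarrow> ereal" where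
  "prox_obj lam f x u = f u + ereal (1 / (2 * lam) * (norm (x - u))\<^sup>2)"

text \<open>For \<open>lam > 0\<close> and \<open>f \<in> Gamma0\<close> the infimum is attained, at exactly one point,
  so \<open>moreau_env\<close> is a minimum and \<open>prox\<close> is well defined.\<close>

definition moreau_env :: "real \<Rightarrow> ('a::real_inner \<Rightarrow> ereal) \<Rightarrow> 'a \<Rightarrow> ereal" where
  "moreau_env lam f x = (INF u. prox_obj lam f x u)"

definition prox :: "real \<Rightarrow> ('a::real_inner \<Rightarrow> ereal) \<Rightarrow> 'a \<Rightarrow> 'a" where
  "prox lam f x = (THE u. \<forall>v. prox_obj lam f x u \<le> prox_obj lam f x v)"

abbreviation proj_cl_dom :: "('a::euclidean_space \<Rightarrow> ereal) \<Rightarrow> 'a \<Rightarrow> 'a" where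
  "proj_cl_dom f x \<equiv> closest_point (closure (edom f)) x"

definition phibar :: "('a::euclidean_space \<Rightarrow> ereal) \<Rightarrow> 'a \<Rightarrow> real \<Rightarrow> ereal" where
  "phibar f x lam =
     (if lam > 0 then - (ereal lam * moreau_env lam f x)
      else if lam = 0 then ereal (- (1/2) * (infdist x (closure (edom f)))\<^sup>2)
      else ereal (- lam) * f (proj_cl_dom f x)
           - ereal (1/2 * (infdist x (closure (edom f)))\<^sup>2))"

text \<open>Derivative of an extended real-valued function of one real variable: the function must
  be finite near the point and the derivative finite. The derivative has type \<^typ>\<open>ereal\<close>
  so that it can be given by values of extended real-valued functions.\<close>

definition has_ereal_deriv :: "(real \<Rightarrow> ereal) \<Rightarrow> ereal \<Rightarrow> real \<Rightarrow> bool" where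
  "has_ereal_deriv g D t \<longleftrightarrow>
     \<bar>D\<bar> \<noteq> \<infinity> \<and> (\<forall>\<^sub>F s in nhds t. \<bar>g s\<bar> \<noteq> \<infinity>) \<and>
     ((\<lambda>s. real_of_ereal (g s)) has_real_derivative real_of_ereal D) (at t)"

definition locally_lipschitz_on ::
    "'a::metric_space set \<Rightarrow> ('a \<Rightarrow> 'b::metric_space) \<Rightarrow> bool" where
  "locally_lipschitz_on S g \<longleftrightarrow>
     (\<forall>x\<in>S. \<exists>\<epsilon>>0. \<exists>L. L-lipschitz_on (cball x \<epsilon> \<inter> S) g)"

end

theory Submission
  imports Defs
begin

text \<open>
  Write \<open>P t\<close> for the proximal point \<open>prox t f x\<close>, \<open>p\<close> for the projection of \<open>x\<close> onto the closure
  of the domain of \<open>f\<close>, and \<open>\<phi>\<close> for \<open>phibar f x\<close>. For \<open>t > 0\<close>,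
  \<open>\<phi> t = - t * f (P t) - \<bar>x - P t\<bar>\<^sup>2 / 2\<close> is the supremum over \<open>u\<close> in the domain of the affine functions
  \<open>t \<mapsto> - t * f u - \<bar>x - u\<bar>\<^sup>2 / 2\<close>, attained at \<open>u = P t\<close>. Hence \<open>- f (P t)\<close> is a subgradient of
  \<open>\<phi>\<close> at \<open>t\<close>, and convexity follows from the existence of subgradients. For \<open>t \<le> 0\<close> and \<open>p\<close> in
  the domain, \<open>\<phi>\<close> is the affine function with slope \<open>- f p\<close>, which minorizes \<open>\<phi>\<close> on the positive axis
  (take \<open>u = p\<close>), so \<open>- f p\<close> is a subgradient there.

  A function of a real variable that has a subgradient selection which is continuous at a point is
  differentiable at that point, with the selected subgradient as derivative
  (\<open>DERIV_subgradient_selection\<close>). Everything about derivatives is therefore a matter of the regularity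
  of \<open>t \<mapsto> f (P t)\<close>. The optimality condition \<open>(x - P t) / t \<in> \<partial>f (P t)\<close> (\<open>prox_subgradient\<close>) and the
  monotonicity of the subdifferential give \<open>\<bar>P s - P t\<bar> \<le> \<bar>s - t\<bar> * (\<bar>x - P s\<bar> / s)\<close>, and from this
  \<open>\<bar>f (P s) - f (P t)\<bar> \<le> K\<^sup>2 * \<bar>s - t\<bar>\<close> whenever \<open>K\<close> bounds both quotients \<open>\<bar>x - P s\<bar> / s\<close> and
  \<open>\<bar>x - P t\<bar> / t\<close> (\<open>prox_value_diff_le\<close>). The quotient is locally bounded on the positive axis, and if \<open>v\<close>
  is a subgradient of \<open>f\<close> at \<open>x\<close> it is bounded by \<open>\<bar>v\<bar>\<close>, so that the derivative is then Lipschitz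
  on the whole line.

  The behaviour at \<open>0\<close> rests on \<open>P t \<longlongrightarrow> p\<close> for \<open>t \<longlongrightarrow> 0+\<close> (\<open>tendsto_prox_0\<close>) and lower semicontinuity.
  If \<open>p\<close> is in the domain, then \<open>f (P t) \<le> f p\<close> and so \<open>f (P t) \<longlongrightarrow> f p\<close>, which makes the subgradient
  selection continuous at \<open>0\<close>. If \<open>p\<close> is not in the domain, a subgradient \<open>v\<close> of \<open>\<phi>\<close> at \<open>0\<close> would
  force \<open>f (P t) \<le> - v\<close> for all \<open>t > 0\<close>, hence \<open>f p \<le> - v\<close>, a contradiction.
\<close>

section \<open>Closed proper convex functions\<close>

lemma Gamma0_real:
  assumes "f \<in> Gamma0" "u \<in> edom f"
  shows "f u = ereal (real_of_ereal (f u))"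
proof -
  have "f u \<noteq> \<infinity>" "f u \<noteq> -\<infinity>"
    using assms by (auto simp: Gamma0_def proper_fun_def edom_def)
  then show ?thesis by (cases "f u") auto
qed

lemma edom_nonempty: "f \<in> Gamma0 \<Longrightarrow> edom f \<noteq> {}"
  by (force simp: Gamma0_def proper_fun_def edom_def)

lemma not_edom: "u \<notin> edom f \<Longrightarrow> f u = \<infinity>"
  by (simp add: edom_def)

lemma mem_eepi_iff:
  assumes "f \<in> Gamma0"
  shows "(u, r) \<in> eepi f \<longleftrightarrow> u \<in> edom f \<and> real_of_ereal (f u) \<le> r"
proof (cases "u \<in> edom f")
  case True
  then show ?thesis using Gamma0_real[OF assms True]
    by (metis (no_types, lifting) eepi_def case_prodI case_prodD mem_Collect_eq ereal_less_eq(3))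
next
  case False
  then show ?thesis by (auto simp: eepi_def not_edom)
qed

lemma Gamma0_convexD:
  assumes f: "f \<in> Gamma0" and u: "u \<in> edom f" and w: "w \<in> edom f" and t: "0 \<le> t" "t \<le> 1"
  shows "(1 - t) *\<^sub>R u + t *\<^sub>R w \<in> edom f" (is ?A)
    and "real_of_ereal (f ((1 - t) *\<^sub>R u + t *\<^sub>R w)) \<le>
           (1 - t) * real_of_ereal (f u) + t * real_of_ereal (f w)" (is ?B)
proof -
  have "convex (eepi f)" using f by (simp add: Gamma0_def convex_fun_def)
  moreover have "(u, real_of_ereal (f u)) \<in> eepi f" "(w, real_of_ereal (f w)) \<in> eepi f"
    using f u w by (simp_all add: mem_eepi_iff)
  ultimately have "(1 - t) *\<^sub>R (u, real_of_ereal (f u)) + t *\<^sub>R (w, real_of_ereal (f w)) \<in> eepi f"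
    using t by (intro convexD) auto
  then show ?A ?B using f by (simp_all add: mem_eepi_iff)
qed

lemma convex_edom: "f \<in> Gamma0 \<Longrightarrow> convex (edom f)"
  unfolding convex_alt using Gamma0_convexD(1) by blast

lemma Gamma0_lsc:
  assumes "f \<in> Gamma0"
  shows "open {u. ereal c < f u}"
proof -
  have "closed ((\<lambda>u. (u, c)) -` eepi f)"
    using assms by (intro continuous_closed_vimage) (auto simp: Gamma0_def closed_fun_def)
  moreover have "{u. ereal c < f u} = - ((\<lambda>u. (u, c)) -` eepi f)"
    by (auto simp: eepi_def)
  ultimately show ?thesis by auto
qed

text \<open>The epigraph is closed and convex, so it can be separated from a point below the graph.\<close>
lemma affine_minorant:
  fixes f :: "'a::euclidean_space \<Rightarrow> ereal"
  assumes f: "f \<in> Gamma0"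
  obtains a b where "\<And>u. u \<in> edom f \<Longrightarrow> a \<bullet> u + b \<le> real_of_ereal (f u)"
proof -
  obtain u0 where u0: "u0 \<in> edom f" using edom_nonempty[OF f] by blast
  let ?g = "\<lambda>u. real_of_ereal (f u)"
  have "convex (eepi f)" "closed (eepi f)"
    using f by (auto simp: Gamma0_def convex_fun_def closed_fun_def)
  moreover have "(u0, ?g u0 - 1) \<notin> eepi f" using f by (simp add: mem_eepi_iff)
  ultimately obtain c \<beta> where c: "c \<bullet> (u0, ?g u0 - 1) < \<beta>" "\<And>z. z \<in> eepi f \<Longrightarrow> \<beta> < c \<bullet> z"
    using separating_hyperplane_closed_point by metis
  obtain d \<alpha> where d: "c = (d, \<alpha>)" by (cases c)
  have sep: "\<beta> < d \<bullet> u + \<alpha> * ?g u" if "u \<in> edom f" for u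
    using c(2)[of "(u, ?g u)"] that f by (simp add: d mem_eepi_iff)
  \<comment> \<open>The separating hyperplane is not vertical: it separates two points of the line over \<open>u0\<close>.\<close>
  have "\<alpha> > 0" using sep[OF u0] c(1) by (simp add: d algebra_simps)
  have "(- (1/\<alpha>) *\<^sub>R d) \<bullet> u + \<beta> / \<alpha> \<le> ?g u" if "u \<in> edom f" for u
    using sep[OF that] \<open>\<alpha> > 0\<close> by (simp add: field_simps)
  then show thesis by (rule that)
qed

section \<open>The proximal point\<close>

text \<open>The objective, read as a continuous function on the epigraph, has a compact sublevel set there,
  because the quadratic term dominates an affine minorant of \<open>f\<close>.\<close>
lemma prox_exists:
  fixes f :: "'a::euclidean_space \<Rightarrow> ereal"
  assumes f: "f \<in> Gamma0" and lam: "lam > 0"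
  obtains p where "p \<in> edom f"
    and "\<And>u. u \<in> edom f \<Longrightarrow> real_of_ereal (f p) + (norm (x - p))\<^sup>2 / (2 * lam)
           \<le> real_of_ereal (f u) + (norm (x - u))\<^sup>2 / (2 * lam)"
proof -
  let ?g = "\<lambda>u. real_of_ereal (f u)"
  let ?h = "\<lambda>z::'a \<times> real. snd z + (norm (x - fst z))\<^sup>2 / (2 * lam)"
  obtain a b where ab: "\<And>u. u \<in> edom f \<Longrightarrow> a \<bullet> u + b \<le> ?g u"
    using affine_minorant[OF f] by blast
  obtain u0 where u0: "u0 \<in> edom f" using edom_nonempty[OF f] by blast
  \<comment> \<open>\<open>C\<close> is the value of the objective at a point of the domain, so its sublevel set \<open>S\<close> is nonempty.\<close>
  define C where "C = ?h (u0, ?g u0)"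
  define S where "S = {z \<in> eepi f. ?h z \<le> C}"
  have cont: "continuous_on A ?h" for A by (intro continuous_intros) (use lam in auto)
  have "closed (eepi f)" using f by (auto simp: Gamma0_def closed_fun_def)
  then have "closed S" unfolding S_def
    by (intro continuous_on_closed_Collect_le cont) auto
  \<comment> \<open>\<open>R\<close> bounds every \<open>n \<ge> 1\<close> with \<open>n\<^sup>2 \<le> 2 * lam * (C - a \<bullet> x - b) + 2 * lam * norm a * n\<close>.\<close>
  define R where "R = 2 * lam * norm a + 2 * lam * (\<bar>C - a \<bullet> x - b\<bar>) + 1"
  have R: "R \<ge> 1" using lam by (simp add: R_def)
  have bd: "norm (x - u) \<le> R \<and> \<bar>r\<bar> \<le> \<bar>C\<bar> + \<bar>b\<bar> + norm a * (norm x + R)" if "(u, r) \<in> S" for u r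
  proof -
    define n where "n = norm (x - u)"
    have n0: "n \<ge> 0" by (simp add: n_def)
    have r: "u \<in> edom f" "?g u \<le> r" "r + n\<^sup>2 / (2 * lam) \<le> C"
      using that f by (auto simp: S_def mem_eepi_iff n_def)
    have lower: "a \<bullet> u + b \<le> r" using ab[OF r(1)] r(2) by linarith
    have ip: "a \<bullet> (x - u) \<le> norm a * n" unfolding n_def by (rule norm_cauchy_schwarz)
    have "n\<^sup>2 / (2 * lam) \<le> C - a \<bullet> x - b + norm a * n"
      using lower r(3) ip by (simp add: inner_diff_right)
    then have sq: "n\<^sup>2 \<le> 2 * lam * (C - a \<bullet> x - b) + 2 * lam * norm a * n"
      using lam by (simp add: field_simps)
    have "n \<le> R"
    proof (rule ccontr)
      assume "\<not> n \<le> R"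
      then have n: "n > R" "n \<ge> 1" using R by auto
      have "2 * lam * (C - a \<bullet> x - b) \<le> 2 * lam * \<bar>C - a \<bullet> x - b\<bar> * n"
        using lam n mult_left_mono[of 1 n "2 * lam * \<bar>C - a \<bullet> x - b\<bar>"]
          mult_left_mono[of "C - a \<bullet> x - b" "\<bar>C - a \<bullet> x - b\<bar>" "2 * lam"] by auto
      then have "n * n \<le> (R - 1) * n" using sq unfolding R_def power2_eq_square
        by (simp add: algebra_simps)
      then show False using n by (simp add: mult_le_cancel_right)
    qed
    have "norm u \<le> norm x + R"
      using norm_triangle_ineq4[of x "x - u"] \<open>n \<le> R\<close> by (simp add: n_def)
    then have "\<bar>a \<bullet> u\<bar> \<le> norm a * (norm x + R)"
      using Cauchy_Schwarz_ineq2[of a u] by (meson mult_left_mono norm_ge_zero order_trans)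
    moreover have "r \<le> C" using r(3) lam zero_le_power2[of n]
      by (smt (verit) divide_nonneg_pos)
    ultimately show ?thesis using lower \<open>n \<le> R\<close> by (auto simp: n_def)
  qed
  have "S \<subseteq> cball x R \<times> cball 0 (\<bar>C\<bar> + \<bar>b\<bar> + norm a * (norm x + R))"
    using bd by (auto simp: dist_norm)
  then have "bounded S" by (rule bounded_subset[OF bounded_Times[OF bounded_cball bounded_cball]])
  with \<open>closed S\<close> have "compact S" by (simp add: compact_eq_bounded_closed)
  have inS: "(u0, ?g u0) \<in> S" using u0 f by (auto simp: S_def C_def mem_eepi_iff)
  obtain z where z: "z \<in> S" "\<And>y. y \<in> S \<Longrightarrow> ?h z \<le> ?h y"
    using continuous_attains_inf[OF \<open>compact S\<close> _ cont] inS by blast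
  obtain p r where pr: "z = (p, r)" by (cases z)
  have p: "p \<in> edom f" "?g p \<le> r" "?h z \<le> C" using z(1) f by (auto simp: S_def pr mem_eepi_iff)
  have "?g p + (norm (x - p))\<^sup>2 / (2 * lam) \<le> ?g u + (norm (x - u))\<^sup>2 / (2 * lam)"
    if u: "u \<in> edom f" for u
  proof (cases "(u, ?g u) \<in> S")
    case True
    then show ?thesis using z(2)[OF True] p(2) by (simp add: pr)
  next
    case False
    then have "?h (u, ?g u) > C" using u f by (auto simp: S_def mem_eepi_iff)
    then show ?thesis using p(2,3) by (simp add: pr)
  qed
  with p(1) show thesis by (rule that)
qed

text \<open>First-order optimality: a minimizer \<open>p\<close> of the proximal objective has \<open>(x - p) / lam\<close> as a subgradient
  of \<open>f\<close>. It is obtained by comparing \<open>p\<close> with the points \<open>p + t (u - p)\<close> as \<open>t\<close> tends to \<open>0\<close>.\<close>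
lemma minimizer_subgradient:
  assumes f: "f \<in> Gamma0" and lam: "lam > 0" and p: "p \<in> edom f" and u: "u \<in> edom f"
    and min: "\<And>u. u \<in> edom f \<Longrightarrow> real_of_ereal (f p) + (norm (x - p))\<^sup>2 / (2 * lam)
           \<le> real_of_ereal (f u) + (norm (x - u))\<^sup>2 / (2 * lam)"
  shows "real_of_ereal (f p) + ((x - p) \<bullet> (u - p)) / lam \<le> real_of_ereal (f u)"
proof -
  let ?g = "\<lambda>u. real_of_ereal (f u)"
  define c where "c = ?g p + ((x - p) \<bullet> (u - p)) / lam - ?g u"
  have bound: "c \<le> t * ((norm (u - p))\<^sup>2 / (2 * lam))" if t: "0 < t" "t < 1" for t
  proof -
    let ?w = "(1 - t) *\<^sub>R p + t *\<^sub>R u"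
    have "x - ?w = (x - p) - t *\<^sub>R (u - p)" by (simp add: algebra_simps)
    then have "(norm (x - ?w))\<^sup>2 =
        (norm (x - p))\<^sup>2 - 2 * t * ((x - p) \<bullet> (u - p)) + t\<^sup>2 * (norm (u - p))\<^sup>2"
      unfolding power2_norm_eq_inner
      by (simp add: inner_diff_left inner_diff_right inner_commute algebra_simps power2_eq_square)
    moreover have "?g p + (norm (x - p))\<^sup>2 / (2 * lam)
        \<le> (1 - t) * ?g p + t * ?g u + (norm (x - ?w))\<^sup>2 / (2 * lam)"
      using min[OF Gamma0_convexD(1)[OF f p u, of t]] Gamma0_convexD(2)[OF f p u, of t] t by simp
    ultimately have "?g p + (norm (x - p))\<^sup>2 / (2 * lam) \<le> (1 - t) * ?g p + t * ?g u +
        ((norm (x - p))\<^sup>2 - 2 * t * ((x - p) \<bullet> (u - p)) + t\<^sup>2 * (norm (u - p))\<^sup>2) / (2 * lam)"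
      by simp
    also have "\<dots> = ?g p + (norm (x - p))\<^sup>2 / (2 * lam) - t * c
        + t * (t * ((norm (u - p))\<^sup>2 / (2 * lam)))"
      using lam unfolding c_def by (simp add: field_simps power2_eq_square)
    finally have "t * c \<le> t * (t * ((norm (u - p))\<^sup>2 / (2 * lam)))" by simp
    then show ?thesis using t(1) by (simp only: mult_le_cancel_left_pos)
  qed
  have "((\<lambda>t. t * ((norm (u - p))\<^sup>2 / (2 * lam))) \<longlongrightarrow> 0 * ((norm (u - p))\<^sup>2 / (2 * lam))) (at_right 0)"
    by (intro tendsto_intros)
  moreover have "\<forall>\<^sub>F t in at_right (0::real). c \<le> t * ((norm (u - p))\<^sup>2 / (2 * lam))"
    using eventually_at_right_real[of 0 1, OF zero_less_one] by eventually_elim (use bound in auto)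
  ultimately have "c \<le> 0 * ((norm (u - p))\<^sup>2 / (2 * lam))"
    using tendsto_lowerbound trivial_limit_at_right_real by blast
  then show ?thesis by (simp add: c_def)
qed

text \<open>Converse of the optimality condition, with the quadratic growth that makes the minimizer unique;
  \<open>gp\<close> and \<open>gu\<close> stand for the values at \<open>p\<close> and \<open>u\<close>.\<close>
lemma subgradient_minimizer:
  fixes x :: "'a::real_inner"
  assumes lam: "lam > 0" and sub: "gp + ((x - p) \<bullet> (u - p)) / lam \<le> gu"
  shows "gp + (norm (x - p))\<^sup>2 / (2 * lam) + (norm (u - p))\<^sup>2 / (2 * lam) \<le> gu + (norm (x - u))\<^sup>2 / (2 * lam)"
proof -
  have "x - u = (x - p) - (u - p)" by simp
  then have "(norm (x - u))\<^sup>2 = (norm (x - p))\<^sup>2 - 2 * ((x - p) \<bullet> (u - p)) + (norm (u - p))\<^sup>2"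
    unfolding power2_norm_eq_inner
    by (simp only: inner_diff_left inner_diff_right inner_commute) (simp add: algebra_simps inner_commute)
  then have "(norm (x - u))\<^sup>2 / (2 * lam) = (norm (x - p))\<^sup>2 / (2 * lam)
      - ((x - p) \<bullet> (u - p)) / lam + (norm (u - p))\<^sup>2 / (2 * lam)"
    using lam by (simp add: field_simps)
  then show ?thesis using sub by linarith
qed

lemma prox_obj_real:
  assumes "f \<in> Gamma0" "u \<in> edom f"
  shows "prox_obj lam f x u = ereal (real_of_ereal (f u) + (norm (x - u))\<^sup>2 / (2 * lam))"
  unfolding prox_obj_def by (subst Gamma0_real[OF assms]) simp

lemma prox_obj_infty: "u \<notin> edom f \<Longrightarrow> prox_obj lam f x u = \<infinity>"
  by (simp add: prox_obj_def not_edom)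

lemma
  fixes f :: "'a::euclidean_space \<Rightarrow> ereal"
  assumes f: "f \<in> Gamma0" and lam: "lam > 0"
  shows prox_in_edom: "prox lam f x \<in> edom f"
    and prox_subgradient: "\<And>u. u \<in> edom f \<Longrightarrow>
      real_of_ereal (f (prox lam f x)) + ((x - prox lam f x) \<bullet> (u - prox lam f x)) / lam
        \<le> real_of_ereal (f u)"
    and moreau_env_prox: "moreau_env lam f x =
      ereal (real_of_ereal (f (prox lam f x)) + (norm (x - prox lam f x))\<^sup>2 / (2 * lam))"
proof -
  obtain p where p: "p \<in> edom f"
    and min: "\<And>u. u \<in> edom f \<Longrightarrow> real_of_ereal (f p) + (norm (x - p))\<^sup>2 / (2 * lam)
           \<le> real_of_ereal (f u) + (norm (x - u))\<^sup>2 / (2 * lam)"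
    using prox_exists[OF f lam] by blast
  note sub = minimizer_subgradient[OF f lam p _ min]
  have le: "prox_obj lam f x p \<le> prox_obj lam f x v" for v
  proof (cases "v \<in> edom f")
    case True
    then show ?thesis using f p min[OF True] by (simp add: prox_obj_real)
  qed (simp add: prox_obj_infty)
  have "prox lam f x = p" unfolding prox_def
  proof (rule the_equality)
    show "\<forall>v. prox_obj lam f x p \<le> prox_obj lam f x v" using le by blast
    fix q assume q: "\<forall>v. prox_obj lam f x q \<le> prox_obj lam f x v"
    have qd: "q \<in> edom f"
    proof (rule ccontr)
      assume "q \<notin> edom f"
      then show False using q[rule_format, of p] f p by (simp add: prox_obj_infty prox_obj_real)
    qed
    have "(norm (q - p))\<^sup>2 / (2 * lam) \<le> 0"
      using subgradient_minimizer[OF lam sub[OF qd]] q[rule_format, of p] f p qd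
      by (simp add: prox_obj_real)
    then have "(norm (q - p))\<^sup>2 \<le> 0" using lam by (simp add: divide_le_0_iff)
    then show "q = p" by simp
  qed
  moreover have "moreau_env lam f x = prox_obj lam f x p"
    unfolding moreau_env_def using le by (intro antisym INF_lower INF_greatest) auto
  ultimately show "prox lam f x \<in> edom f"
    "\<And>u. u \<in> edom f \<Longrightarrow>
      real_of_ereal (f (prox lam f x)) + ((x - prox lam f x) \<bullet> (u - prox lam f x)) / lam
        \<le> real_of_ereal (f u)"
    "moreau_env lam f x =
      ereal (real_of_ereal (f (prox lam f x)) + (norm (x - prox lam f x))\<^sup>2 / (2 * lam))"
    using p sub f by (simp_all add: prox_obj_real)
qed


section \<open>Dependence of the proximal point on the parameter\<close>

lemma norm_prox_diff_le:
  assumes f: "f \<in> Gamma0" and lam: "lam > 0" and mu: "mu > 0"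
  shows "norm (prox lam f x - prox mu f x) \<le> \<bar>lam - mu\<bar> * (norm (x - prox lam f x) / lam)"
proof -
  define d where "d = x - prox lam f x"
  define w where "w = prox lam f x - prox mu f x"
  have eq: "x - prox mu f x = d + w" "prox mu f x - prox lam f x = - w"
    by (simp_all add: d_def w_def)
  \<comment> \<open>Monotonicity of the subdifferential at the two proximal points.\<close>
  have "(d \<bullet> (- w)) / lam + ((d + w) \<bullet> w) / mu \<le> 0"
    using prox_subgradient[OF f lam prox_in_edom[OF f mu, of x], of x]
      prox_subgradient[OF f mu prox_in_edom[OF f lam, of x], of x]
    unfolding eq d_def[symmetric] w_def[symmetric] by linarith
  then have "lam * (w \<bullet> w) \<le> (mu - lam) * (d \<bullet> w)"
    using lam mu by (simp add: field_simps inner_add_left)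
  also have "\<dots> \<le> \<bar>mu - lam\<bar> * \<bar>d \<bullet> w\<bar>"
    by (metis abs_ge_self abs_mult)
  also have "\<dots> \<le> \<bar>mu - lam\<bar> * (norm d * norm w)"
    by (intro mult_left_mono Cauchy_Schwarz_ineq2) auto
  finally have *: "norm w * (lam * norm w) \<le> norm w * (\<bar>lam - mu\<bar> * norm d)"
    by (simp add: dot_square_norm power2_eq_square abs_minus_commute mult_ac)
  have "lam * norm w \<le> \<bar>lam - mu\<bar> * norm d"
  proof (cases "w = 0")
    case False
    then have "norm w > 0" by simp
    with * show ?thesis by (simp only: mult_le_cancel_left_pos)
  qed simp
  then show ?thesis using lam by (simp add: pos_le_divide_eq mult.commute flip: d_def w_def)
qed

text \<open>The vector \<open>(x - prox a f x) / a\<close> is a subgradient of norm at most \<open>K\<close>, and the proximal points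
  themselves are at distance at most \<open>K * \<bar>a - b\<bar>\<close>; this accounts for the square.\<close>
lemma prox_value_diff_le:
  assumes f: "f \<in> Gamma0" and lam: "lam > 0" and mu: "mu > 0"
    and K: "norm (x - prox lam f x) / lam \<le> K" "norm (x - prox mu f x) / mu \<le> K"
  shows "\<bar>real_of_ereal (f (prox lam f x)) - real_of_ereal (f (prox mu f x))\<bar> \<le> K\<^sup>2 * \<bar>lam - mu\<bar>"
proof -
  have *: "real_of_ereal (f (prox a f x)) - real_of_ereal (f (prox b f x)) \<le> K\<^sup>2 * \<bar>a - b\<bar>"
    if a: "a > 0" "norm (x - prox a f x) / a \<le> K" and b: "b > 0" for a b
  proof -
    let ?p = "prox a f x" and ?q = "prox b f x"
    have K0: "K \<ge> 0" using a by (meson divide_nonneg_pos norm_ge_zero order_trans)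
    have "norm (?p - ?q) \<le> \<bar>a - b\<bar> * K"
      using norm_prox_diff_le[OF f a(1) b, of x] a(2) by (meson abs_ge_zero mult_left_mono order_trans)
    then have "norm (x - ?p) / a * norm (?p - ?q) \<le> K * (\<bar>a - b\<bar> * K)"
      using a K0 by (intro mult_mono) auto
    then have "norm (x - ?p) * norm (?p - ?q) / a \<le> K\<^sup>2 * \<bar>a - b\<bar>"
      by (simp add: power2_eq_square mult_ac)
    moreover have "- ((x - ?p) \<bullet> (?q - ?p)) \<le> norm (x - ?p) * norm (?p - ?q)"
      using norm_cauchy_schwarz[of "x - ?p" "?p - ?q"] by (simp add: inner_diff_right)
    then have "- ((x - ?p) \<bullet> (?q - ?p)) / a \<le> norm (x - ?p) * norm (?p - ?q) / a"
      using a by (intro divide_right_mono) auto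
    then have "- (((x - ?p) \<bullet> (?q - ?p)) / a) \<le> norm (x - ?p) * norm (?p - ?q) / a" by simp
    ultimately show ?thesis
      using prox_subgradient[OF f a(1) prox_in_edom[OF f b, of x], of x]
      by linarith
  qed
  show ?thesis using *[OF lam K(1) mu] *[OF mu K(2) lam] by (simp add: abs_le_iff abs_minus_commute)
qed

lemma norm_prox_quotient_local_le:
  assumes f: "f \<in> Gamma0" and lam: "lam > 0" and mu: "\<bar>lam - mu\<bar> \<le> lam / 2"
  shows "norm (x - prox mu f x) / mu \<le> 3 * norm (x - prox lam f x) / lam"
proof -
  let ?n = "norm (x - prox lam f x)"
  have mu2: "mu \<ge> lam / 2" using mu unfolding abs_le_iff by linarith
  have "norm (x - prox mu f x) \<le> ?n + norm (prox lam f x - prox mu f x)"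
    using norm_triangle_ineq[of "x - prox lam f x" "prox lam f x - prox mu f x"] by simp
  also have "\<dots> \<le> ?n + \<bar>lam - mu\<bar> * (?n / lam)"
    using norm_prox_diff_le[OF f lam, of mu x] mu2 lam by simp
  also have "\<dots> \<le> ?n + lam / 2 * (?n / lam)"
    using mu lam by (intro add_left_mono mult_right_mono) auto
  also have "\<dots> = 3 * ?n / lam * (lam / 2)" using lam by simp
  also have "\<dots> \<le> 3 * ?n / lam * mu" using mu2 lam by (intro mult_left_mono) auto
  finally show ?thesis using mu2 lam by (simp add: pos_divide_le_eq)
qed

lemma norm_prox_quotient_le_subgradient:
  assumes f: "f \<in> Gamma0" and lam: "lam > 0" and x: "x \<in> edom f"
    and v: "\<And>u. u \<in> edom f \<Longrightarrow> real_of_ereal (f x) + v \<bullet> (u - x) \<le> real_of_ereal (f u)"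
  shows "norm (x - prox lam f x) / lam \<le> norm v"
proof -
  let ?p = "prox lam f x"
  have "((x - ?p) \<bullet> (x - ?p)) / lam \<le> v \<bullet> (x - ?p)"
    using prox_subgradient[OF f lam x, of x] v[OF prox_in_edom[OF f lam, of x]]
    by (simp add: inner_diff_right)
  also have "\<dots> \<le> norm v * norm (x - ?p)" by (rule norm_cauchy_schwarz)
  finally have *: "norm (x - ?p) * (norm (x - ?p) / lam) \<le> norm (x - ?p) * norm v"
    by (simp add: dot_square_norm power2_eq_square mult.commute)
  then show ?thesis
  proof (cases "x = ?p")
    case False
    then have "norm (x - ?p) > 0" by simp
    with * show ?thesis by (simp only: mult_le_cancel_left_pos)
  qed simp
qed

text \<open>The proximal points with parameter in \<open>(0, 1]\<close> stay within \<open>norm (x - prox 1 f x)\<close> of \<open>prox 1 f x\<close>,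
  so the subgradient inequality at \<open>prox 1 f x\<close> bounds their values from below.\<close>
lemma prox_value_lower_bound:
  assumes f: "f \<in> Gamma0"
  obtains m where "\<And>lam. 0 < lam \<Longrightarrow> lam \<le> 1 \<Longrightarrow> m \<le> real_of_ereal (f (prox lam f x))"
proof -
  let ?p = "prox 1 f x"
  have "real_of_ereal (f ?p) - norm (x - ?p) * norm (x - ?p) \<le> real_of_ereal (f (prox lam f x))"
    if lam: "0 < lam" "lam \<le> 1" for lam
  proof -
    let ?q = "prox lam f x"
    have "norm (?p - ?q) \<le> \<bar>1 - lam\<bar> * norm (x - ?p)"
      using norm_prox_diff_le[OF f, of 1 lam x] lam by simp
    also have "\<dots> \<le> 1 * norm (x - ?p)" using lam by (intro mult_right_mono) auto
    finally have "norm (x - ?p) * norm (?p - ?q) \<le> norm (x - ?p) * norm (x - ?p)"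
      by (intro mult_left_mono) auto
    moreover have "- ((x - ?p) \<bullet> (?q - ?p)) \<le> norm (x - ?p) * norm (?p - ?q)"
      using norm_cauchy_schwarz[of "x - ?p" "?p - ?q"] by (simp add: inner_diff_right)
    ultimately show ?thesis
      using prox_subgradient[OF f zero_less_one prox_in_edom[OF f lam(1), of x], of x] by simp
  qed
  then show thesis by (rule that)
qed

section \<open>Subgradients of the function of the parameter\<close>

text \<open>The values of \<open>phibar f x\<close> as real numbers. On the domain of \<open>phibar f x\<close> the two functions agree. If the
  projection is outside the domain of \<open>f\<close>, then \<open>phi_real\<close> still has the correct value at \<open>0\<close>, where the
  factor \<open>lam\<close> vanishes, but its values at negative arguments have no meaning.\<close>
definition phi_real :: "('a::euclidean_space \<Rightarrow> ereal) \<Rightarrow> 'a \<Rightarrow> real \<Rightarrow> real" where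
  "phi_real f x lam =
     (if lam > 0 then - lam * real_of_ereal (f (prox lam f x)) - (norm (x - prox lam f x))\<^sup>2 / 2
      else - lam * real_of_ereal (f (proj_cl_dom f x)) - (norm (x - proj_cl_dom f x))\<^sup>2 / 2)"

text \<open>The subgradient selection for \<open>phi_real\<close>. At nonpositive arguments it is meaningful only if the
  projection is in the domain of \<open>f\<close>.\<close>
definition phi_slope :: "('a::euclidean_space \<Rightarrow> ereal) \<Rightarrow> 'a \<Rightarrow> real \<Rightarrow> real" where
  "phi_slope f x lam = - real_of_ereal (f (if lam > 0 then prox lam f x else proj_cl_dom f x))"

lemma norm_closest_point_eq_infdist:
  fixes S :: "'a::euclidean_space set"
  assumes "closed S" "S \<noteq> {}"
  shows "norm (x - closest_point S x) = infdist x S"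
  using assms by (simp add: infdist_eq_setdist setdist_closest_point dist_norm)

lemma phibar_eq_phi_real:
  assumes f: "f \<in> Gamma0" and lam: "lam \<ge> 0 \<or> proj_cl_dom f x \<in> edom f"
  shows "phibar f x lam = ereal (phi_real f x lam)"
proof -
  have d: "infdist x (closure (edom f)) = norm (x - proj_cl_dom f x)"
    using edom_nonempty[OF f] by (simp add: norm_closest_point_eq_infdist)
  consider "lam > 0" | "lam = 0" | "lam < 0" "proj_cl_dom f x \<in> edom f" using lam by linarith
  then show ?thesis
  proof cases
    case 1
    then show ?thesis
      by (simp add: phibar_def phi_real_def moreau_env_prox[OF f] field_simps)
  next
    case 2
    then show ?thesis by (simp add: phibar_def phi_real_def d)
  next
    case 3
    obtain r where "f (proj_cl_dom f x) = ereal r" using Gamma0_real[OF f 3(2)] by blast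
    then show ?thesis using 3(1) by (simp add: phibar_def phi_real_def d)
  qed
qed

lemma phibar_infty:
  assumes "lam < 0" "proj_cl_dom f x \<notin> edom f"
  shows "phibar f x lam = \<infinity>"
  using assms by (simp add: phibar_def not_edom)

lemma edom_phibar:
  assumes "f \<in> Gamma0"
  shows "edom (phibar f x) = (if proj_cl_dom f x \<in> edom f then UNIV else {0..})"
proof -
  have "phibar f x lam < \<infinity> \<longleftrightarrow> lam \<ge> 0 \<or> proj_cl_dom f x \<in> edom f" for lam
    using phibar_eq_phi_real[OF assms, of lam x] phibar_infty[of lam f x] by fastforce
  then show ?thesis by (auto simp: edom_def)
qed

lemma norm_proj_cl_dom_le: "u \<in> edom f \<Longrightarrow> norm (x - proj_cl_dom f x) \<le> norm (x - u)"
  using closest_point_le[of "closure (edom f)" u x] closure_subset[of "edom f"]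
  by (auto simp: dist_norm)

lemma phi_real_ge_affine:
  assumes f: "f \<in> Gamma0" and u: "u \<in> edom f" and lam: "lam \<ge> 0"
  shows "- lam * real_of_ereal (f u) - (norm (x - u))\<^sup>2 / 2 \<le> phi_real f x lam"
proof (cases "lam = 0")
  case True
  then show ?thesis using norm_proj_cl_dom_le[OF u, of x] by (simp add: phi_real_def power_mono)
next
  case False
  then have pos: "lam > 0" using lam by simp
  have "real_of_ereal (f (prox lam f x)) + (norm (x - prox lam f x))\<^sup>2 / (2 * lam)
      \<le> real_of_ereal (f u) + (norm (x - u))\<^sup>2 / (2 * lam)"
    using subgradient_minimizer[OF pos prox_subgradient[OF f pos u, of x]] pos
    by (smt (verit) divide_nonneg_pos zero_le_power2)
  then have "lam * (real_of_ereal (f (prox lam f x)) + (norm (x - prox lam f x))\<^sup>2 / (2 * lam))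
      \<le> lam * (real_of_ereal (f u) + (norm (x - u))\<^sup>2 / (2 * lam))"
    using pos by (intro mult_left_mono) auto
  then show ?thesis using pos by (simp add: phi_real_def distrib_left)
qed

lemma phi_real_subgradient_proj:
  assumes f: "f \<in> Gamma0" and p: "proj_cl_dom f x \<in> edom f" and lam: "lam \<le> 0"
  shows "phi_real f x lam + phi_slope f x lam * (mu - lam) \<le> phi_real f x mu"
proof (cases "mu > 0")
  case True
  then show ?thesis using phi_real_ge_affine[OF f p, of mu x] lam
    by (simp add: phi_real_def phi_slope_def algebra_simps)
next
  case False
  then show ?thesis using lam by (simp add: phi_real_def phi_slope_def algebra_simps)
qed

lemma phi_real_subgradient_prox:
  assumes f: "f \<in> Gamma0" and lam: "lam > 0" and mu: "mu \<ge> 0 \<or> proj_cl_dom f x \<in> edom f"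
  shows "phi_real f x lam + phi_slope f x lam * (mu - lam) \<le> phi_real f x mu"
proof (cases "mu \<ge> 0")
  case True
  then show ?thesis using phi_real_ge_affine[OF f prox_in_edom[OF f lam, of x] True, of x] lam
    by (simp add: phi_real_def phi_slope_def algebra_simps)
next
  case False
  let ?p = "proj_cl_dom f x" and ?q = "prox lam f x"
  have p: "?p \<in> edom f" using mu False by simp
  have d: "(norm (x - ?p))\<^sup>2 \<le> (norm (x - ?q))\<^sup>2"
    using norm_proj_cl_dom_le[OF prox_in_edom[OF f lam, of x], of x] by (simp add: power_mono)
  have "- lam * real_of_ereal (f ?p) - (norm (x - ?p))\<^sup>2 / 2 \<le>
      - lam * real_of_ereal (f ?q) - (norm (x - ?q))\<^sup>2 / 2"
    using phi_real_ge_affine[OF f p, of lam x] lam by (simp add: phi_real_def)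
  then have "lam * real_of_ereal (f ?q) \<le> lam * real_of_ereal (f ?p)" using d by linarith
  then have "real_of_ereal (f ?q) \<le> real_of_ereal (f ?p)" using lam by simp
  then have "mu * real_of_ereal (f ?p) \<le> mu * real_of_ereal (f ?q)"
    using False by (intro mult_left_mono_neg) auto
  moreover have "phi_real f x mu = - mu * real_of_ereal (f ?p) - (norm (x - ?p))\<^sup>2 / 2"
    using False by (simp add: phi_real_def)
  moreover have "phi_real f x lam + phi_slope f x lam * (mu - lam) =
      - mu * real_of_ereal (f ?q) - (norm (x - ?q))\<^sup>2 / 2"
    using lam by (simp add: phi_real_def phi_slope_def algebra_simps)
  ultimately show ?thesis using d by linarith
qed

section \<open>The limit at zero\<close>

text \<open>The lower bound comes from the affine minorants with \<open>u\<close> in the domain close to the projection, the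
  upper bound from a lower bound for the values at the proximal points.\<close>
lemma tendsto_phi_real_0:
  assumes f: "f \<in> Gamma0"
  shows "(phi_real f x \<longlongrightarrow> phi_real f x 0) (at_right 0)"
proof (rule order_tendstoI)
  let ?p = "proj_cl_dom f x"
  have p: "?p \<in> closure (edom f)" using edom_nonempty[OF f] by (intro closest_point_in_set) auto
  obtain m where m: "\<And>lam. 0 < lam \<Longrightarrow> lam \<le> 1 \<Longrightarrow> m \<le> real_of_ereal (f (prox lam f x))"
    using prox_value_lower_bound[OF f] by blast
  fix a
  {
    assume a: "a < phi_real f x 0"
    have "open {w. a < - (norm (x - w))\<^sup>2 / 2}"
      by (intro open_Collect_less continuous_intros) auto
    moreover have "?p \<in> {w. a < - (norm (x - w))\<^sup>2 / 2}" using a by (simp add: phi_real_def)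
    ultimately obtain w where w: "w \<in> edom f" "a < - (norm (x - w))\<^sup>2 / 2"
      using p unfolding closure_iff_nhds_not_empty
      by (metis (mono_tags, lifting) Int_iff disjoint_iff mem_Collect_eq order_refl)
    have "((\<lambda>lam. - lam * real_of_ereal (f w) - (norm (x - w))\<^sup>2 / 2) \<longlongrightarrow>
        - 0 * real_of_ereal (f w) - (norm (x - w))\<^sup>2 / 2) (at_right 0)"
      by (intro tendsto_intros)
    then have "\<forall>\<^sub>F lam in at_right 0. a < - lam * real_of_ereal (f w) - (norm (x - w))\<^sup>2 / 2"
      using w(2) by (intro order_tendstoD(1)) auto
    then show "\<forall>\<^sub>F lam in at_right 0. a < phi_real f x lam"
      using eventually_at_right_less[of 0]
    proof eventually_elim
      case (elim lam)
      then show ?case using phi_real_ge_affine[OF f w(1), of lam x] by linarith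
    qed
  next
    assume a: "phi_real f x 0 < a"
    have "((\<lambda>lam. - lam * m - (norm (x - ?p))\<^sup>2 / 2) \<longlongrightarrow>
        - 0 * m - (norm (x - ?p))\<^sup>2 / 2) (at_right 0)"
      by (intro tendsto_intros)
    then have "\<forall>\<^sub>F lam in at_right 0. - lam * m - (norm (x - ?p))\<^sup>2 / 2 < a"
      using a by (intro order_tendstoD(2)) (auto simp: phi_real_def)
    then show "\<forall>\<^sub>F lam in at_right 0. phi_real f x lam < a"
      using eventually_at_right_real[of 0 1, OF zero_less_one]
    proof eventually_elim
      case (elim lam)
      then have lam: "0 < lam" "lam \<le> 1" by auto
      have "(norm (x - ?p))\<^sup>2 \<le> (norm (x - prox lam f x))\<^sup>2"
        using norm_proj_cl_dom_le[OF prox_in_edom[OF f lam(1), of x], of x] by (simp add: power_mono)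
      moreover have "lam * m \<le> lam * real_of_ereal (f (prox lam f x))"
        using m[OF lam] lam by simp
      moreover have "phi_real f x lam =
          - lam * real_of_ereal (f (prox lam f x)) - (norm (x - prox lam f x))\<^sup>2 / 2"
        using lam by (simp add: phi_real_def)
      ultimately have "phi_real f x lam \<le> - lam * m - (norm (x - ?p))\<^sup>2 / 2" by linarith
      then show ?case using elim by linarith
    qed
  }
qed

text \<open>By the obtuse angle property of the projection, \<open>\<bar>P - p\<bar>\<^sup>2 \<le> \<bar>x - P\<bar>\<^sup>2 - \<bar>x - p\<bar>\<^sup>2\<close> for the proximal
  point \<open>P\<close> and the projection \<open>p\<close>, and the limit of \<open>phi_real\<close> controls \<open>\<bar>x - P\<bar>\<close>.\<close>
lemma tendsto_prox_0:
  assumes f: "f \<in> Gamma0"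
  shows "((\<lambda>lam. prox lam f x) \<longlongrightarrow> proj_cl_dom f x) (at_right 0)"
proof -
  let ?p = "proj_cl_dom f x"
  obtain m where m: "\<And>lam. 0 < lam \<Longrightarrow> lam \<le> 1 \<Longrightarrow> m \<le> real_of_ereal (f (prox lam f x))"
    using prox_value_lower_bound[OF f] by blast
  define B where "B lam = - 2 * phi_real f x lam - 2 * (lam * m) - (norm (x - ?p))\<^sup>2" for lam
  have "(B \<longlongrightarrow> - 2 * phi_real f x 0 - 2 * (0 * m) - (norm (x - ?p))\<^sup>2) (at_right 0)"
    unfolding B_def by (intro tendsto_intros tendsto_phi_real_0[OF f])
  then have B0: "(B \<longlongrightarrow> 0) (at_right 0)" by (simp add: phi_real_def)
  have "(norm (prox lam f x - ?p))\<^sup>2 \<le> B lam" if lam: "0 < lam" "lam \<le> 1" for lam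
  proof -
    let ?q = "prox lam f x"
    have "(x - ?p) \<bullet> (?q - ?p) \<le> 0"
      using prox_in_edom[OF f lam(1), of x] convex_edom[OF f] closure_subset
      by (intro closest_point_dot convex_closure) auto
    moreover have "x - ?q = (x - ?p) - (?q - ?p)" by simp
    then have "(norm (x - ?q))\<^sup>2 = (norm (x - ?p))\<^sup>2 - 2 * ((x - ?p) \<bullet> (?q - ?p)) + (norm (?q - ?p))\<^sup>2"
      unfolding power2_norm_eq_inner
      by (simp only: inner_diff_left inner_diff_right inner_commute) (simp add: algebra_simps inner_commute)
    moreover have "lam * m \<le> lam * real_of_ereal (f ?q)" using m[OF lam] lam by simp
    moreover have "phi_real f x lam = - (lam * real_of_ereal (f ?q)) - (norm (x - ?q))\<^sup>2 / 2"
      using lam by (simp add: phi_real_def)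
    ultimately show ?thesis unfolding B_def by linarith
  qed
  then have "\<forall>\<^sub>F lam in at_right 0. norm ((norm (prox lam f x - ?p))\<^sup>2) \<le> B lam"
    using eventually_at_right_real[of 0 1, OF zero_less_one] by (auto elim!: eventually_mono)
  then have "((\<lambda>lam. (norm (prox lam f x - ?p))\<^sup>2) \<longlongrightarrow> 0) (at_right 0)"
    by (rule Lim_null_comparison[OF _ B0])
  then have "((\<lambda>lam. norm (prox lam f x - ?p)) \<longlongrightarrow> 0) (at_right 0)"
    using tendsto_real_sqrt[of "\<lambda>lam. (norm (prox lam f x - ?p))\<^sup>2" 0 "at_right 0"] by simp
  then show ?thesis by (simp add: tendsto_norm_zero_iff LIM_zero_iff)
qed

section \<open>Regularity of the slope\<close>

lemma phi_slope_lipschitz_near: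
  assumes f: "f \<in> Gamma0" and lam: "lam > 0"
  shows "((3 * norm (x - prox lam f x) / lam)\<^sup>2)-lipschitz_on (cball lam (lam / 2)) (phi_slope f x)"
proof (rule lipschitz_onI)
  fix a b assume ab: "a \<in> cball lam (lam / 2)" "b \<in> cball lam (lam / 2)"
  then have "\<bar>lam - a\<bar> \<le> lam / 2" "\<bar>lam - b\<bar> \<le> lam / 2" by (auto simp: dist_real_def)
  moreover from this have "a > 0" "b > 0" using lam by linarith+
  ultimately show "dist (phi_slope f x a) (phi_slope f x b) \<le>
      (3 * norm (x - prox lam f x) / lam)\<^sup>2 * dist a b"
    using prox_value_diff_le[OF f, of a b x, OF _ _ norm_prox_quotient_local_le[OF f lam]
        norm_prox_quotient_local_le[OF f lam]]
    by (simp add: phi_slope_def dist_real_def abs_minus_commute)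
qed simp

lemma isCont_phi_slope_pos:
  assumes f: "f \<in> Gamma0" and lam: "lam > 0"
  shows "isCont (phi_slope f x) lam"
proof -
  have "continuous_on (ball lam (lam / 2)) (phi_slope f x)"
    using lipschitz_on_continuous_on[OF phi_slope_lipschitz_near[OF f lam]]
    by (rule continuous_on_subset) (rule ball_subset_cball)
  then show ?thesis using lam by (simp add: continuous_on_eq_continuous_at)
qed

text \<open>Continuity at \<open>0\<close> from the right combines lower semicontinuity of \<open>f\<close> at the projection with
  monotonicity of the subgradient selection.\<close>
lemma isCont_phi_slope:
  assumes f: "f \<in> Gamma0" and p: "proj_cl_dom f x \<in> edom f"
  shows "isCont (phi_slope f x) lam"
proof -
  let ?p = "proj_cl_dom f x"
  consider "lam > 0" | "lam < 0" | "lam = 0" by linarith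
  then show ?thesis
  proof cases
    case 1
    then show ?thesis by (rule isCont_phi_slope_pos[OF f])
  next
    case 2
    have "\<forall>\<^sub>F t in nhds lam. t < 0" using 2 by (rule eventually_nhds_in_open[OF open_lessThan, simplified])
    then have "\<forall>\<^sub>F t in nhds lam. phi_slope f x t = - real_of_ereal (f ?p)"
      by eventually_elim (simp add: phi_slope_def)
    then show ?thesis by (simp add: isCont_cong)
  next
    case 3
    have "((\<lambda>t. real_of_ereal (f (prox t f x))) \<longlongrightarrow> real_of_ereal (f ?p)) (at_right 0)"
    proof (rule order_tendstoI)
      fix a assume a: "a < real_of_ereal (f ?p)"
      then have "?p \<in> {u. ereal a < f u}" using Gamma0_real[OF f p]
        by (metis ereal_less(2) less_ereal.simps(1) mem_Collect_eq)
      then have "\<forall>\<^sub>F t in at_right 0. ereal a < f (prox t f x)"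
        using topological_tendstoD[OF tendsto_prox_0[OF f] Gamma0_lsc[OF f]] by force
      then show "\<forall>\<^sub>F t in at_right 0. a < real_of_ereal (f (prox t f x))"
        using eventually_at_right_less[of 0]
      proof eventually_elim
        case (elim t)
        then show ?case using Gamma0_real[OF f prox_in_edom[OF f, of t x]]
          by (metis less_ereal.simps(1))
      qed
    next
      fix a assume a: "real_of_ereal (f ?p) < a"
      have "real_of_ereal (f (prox t f x)) \<le> real_of_ereal (f ?p)" if t: "t > 0" for t
      proof -
        have "phi_slope f x 0 * t \<le> phi_slope f x t * t"
          using phi_real_subgradient_prox[OF f t, of 0 x] phi_real_subgradient_proj[OF f p order_refl, of t]
          by simp
        then show ?thesis using t by (simp add: phi_slope_def)
      qed
      then show "\<forall>\<^sub>F t in at_right 0. real_of_ereal (f (prox t f x)) < a"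
        using eventually_at_right_less[of "0::real"] a by (auto elim!: eventually_mono intro: le_less_trans)
    qed
    then have "((\<lambda>t. - real_of_ereal (f (prox t f x))) \<longlongrightarrow> phi_slope f x 0) (at_right 0)"
      by (auto simp: phi_slope_def intro: tendsto_minus)
    moreover have "\<forall>\<^sub>F t in at_right 0. phi_slope f x t = - real_of_ereal (f (prox t f x))"
      using eventually_at_right_less[of 0] by eventually_elim (simp add: phi_slope_def)
    ultimately have "(phi_slope f x \<longlongrightarrow> phi_slope f x 0) (at_right 0)"
      by (simp add: tendsto_cong)
    moreover have "\<forall>\<^sub>F t in at_left 0. phi_slope f x t = phi_slope f x 0"
      using eventually_at_left_real[of "-1" 0] by (auto simp: phi_slope_def elim!: eventually_mono)
    then have "(phi_slope f x \<longlongrightarrow> phi_slope f x 0) (at_left 0)" by (rule tendsto_eventually)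
    ultimately show ?thesis using 3 by (simp add: isCont_def filterlim_split_at)
  qed
qed

section \<open>Differentiability, continuity and convexity\<close>

text \<open>The subgradient inequalities at \<open>t\<close> and at \<open>y\<close> place the difference quotient between \<open>s t\<close> and \<open>s y\<close>.\<close>
lemma DERIV_subgradient_selection:
  fixes F s :: "real \<Rightarrow> real"
  assumes U: "open U" "t \<in> U" and cont: "isCont s t"
    and sub: "\<And>a b. a \<in> U \<Longrightarrow> b \<in> U \<Longrightarrow> F a + s a * (b - a) \<le> F b"
  shows "(F has_real_derivative s t) (at t)"
proof -
  have "\<bar>(F y - F t) / (y - t) - s t\<bar> \<le> \<bar>s y - s t\<bar>" if y: "y \<in> U" "y \<noteq> t" for y
  proof -
    have "F y + s y * (t - y) \<le> F t" using sub[OF y(1) U(2)] .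
    then have "F y - F t - s t * (y - t) \<le> (s y - s t) * (y - t)" by (simp add: algebra_simps)
    moreover have "0 \<le> F y - F t - s t * (y - t)" using sub[OF U(2) y(1)] by linarith
    ultimately have "\<bar>F y - F t - s t * (y - t)\<bar> \<le> \<bar>(s y - s t) * (y - t)\<bar>" by linarith
    then have "\<bar>F y - F t - s t * (y - t)\<bar> \<le> \<bar>s y - s t\<bar> * \<bar>y - t\<bar>"
      by (simp only: abs_mult)
    then have "\<bar>F y - F t - s t * (y - t)\<bar> / \<bar>y - t\<bar> \<le> \<bar>s y - s t\<bar>"
      using y(2) by (simp add: pos_divide_le_eq)
    moreover have "(F y - F t) / (y - t) - s t = (F y - F t - s t * (y - t)) / (y - t)"
      using y(2) by (simp add: field_simps)
    ultimately show ?thesis by (simp only: abs_divide)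
  qed
  then have "\<forall>\<^sub>F y in at t. norm ((F y - F t) / (y - t) - s t) \<le> \<bar>s y - s t\<bar>"
    using eventually_at_in_open[OF U] by (auto elim!: eventually_mono)
  moreover have "((\<lambda>y. \<bar>s y - s t\<bar>) \<longlongrightarrow> 0) (at t)"
    using cont by (intro tendsto_rabs_zero) (simp add: LIM_zero_iff isCont_def)
  ultimately have "((\<lambda>y. (F y - F t) / (y - t) - s t) \<longlongrightarrow> 0) (at t)"
    by (rule Lim_null_comparison)
  then show ?thesis by (simp add: has_field_derivative_iff LIM_zero_iff)
qed

lemma DERIV_phi_real:
  assumes f: "f \<in> Gamma0" and lam: "lam > 0 \<or> proj_cl_dom f x \<in> edom f"
  shows "(phi_real f x has_real_derivative phi_slope f x lam) (at lam)"
proof (cases "proj_cl_dom f x \<in> edom f")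
  case True
  have "phi_real f x a + phi_slope f x a * (b - a) \<le> phi_real f x b" for a b
    using phi_real_subgradient_prox[OF f, of a b x] phi_real_subgradient_proj[OF f True, of a b] True
    by (cases "a > 0") auto
  then show ?thesis by (intro DERIV_subgradient_selection[of UNIV] isCont_phi_slope[OF f True]) auto
next
  case False
  then show ?thesis using lam
    by (intro DERIV_subgradient_selection[of "{0<..}"] isCont_phi_slope_pos[OF f]
        phi_real_subgradient_prox[OF f]) auto
qed

lemma continuous_on_phi_real:
  assumes f: "f \<in> Gamma0"
  shows "continuous_on (edom (phibar f x)) (phi_real f x)"
proof -
  have "continuous (at lam within edom (phibar f x)) (phi_real f x)" if "lam \<in> edom (phibar f x)" for lam
  proof (cases "lam > 0 \<or> proj_cl_dom f x \<in> edom f")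
    case True
    then show ?thesis using DERIV_isCont[OF DERIV_phi_real[OF f]] continuous_at_imp_continuous_at_within
      by blast
  next
    case False
    then have "lam = 0" "edom (phibar f x) = {0..}" using that by (auto simp: edom_phibar[OF f])
    then show ?thesis using tendsto_phi_real_0[OF f, of x]
      by (simp add: continuous_within at_within_Ici_at_right)
  qed
  then show ?thesis by (simp add: continuous_on_eq_continuous_within)
qed

lemma convex_on_phi_real:
  assumes f: "f \<in> Gamma0"
  shows "convex_on (edom (phibar f x)) (phi_real f x)"
proof (rule convex_onI)
  let ?E = "edom (phibar f x)"
  show conv: "convex ?E" by (simp add: edom_phibar[OF f])
  fix t a b :: real assume t: "0 < t" "t < 1" and ab: "a \<in> ?E" "b \<in> ?E"
  let ?z = "(1 - t) *\<^sub>R a + t *\<^sub>R b"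
  let ?F = "phi_real f x" and ?s = "phi_slope f x"
  \<comment> \<open>A subgradient at \<open>?z\<close> suffices. None is available only when \<open>0\<close> is the left end of the domain and
    \<open>?z = 0\<close>, and then \<open>a = b = 0\<close>.\<close>
  show "?F ?z \<le> (1 - t) * ?F a + t * ?F b"
  proof (cases "?z > 0 \<or> proj_cl_dom f x \<in> edom f")
    case True
    have sub: "?F ?z + ?s ?z * (c - ?z) \<le> ?F c" if "c \<in> ?E" for c
      using phi_real_subgradient_prox[OF f, of ?z c x] phi_real_subgradient_proj[OF f, of x ?z c] True that
      by (cases "?z > 0") (auto simp: edom_phibar[OF f] split: if_splits)
    have "(1 - t) * (?F ?z + ?s ?z * (a - ?z)) + t * (?F ?z + ?s ?z * (b - ?z))
        \<le> (1 - t) * ?F a + t * ?F b"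
      using t by (intro add_mono mult_left_mono sub ab) auto
    also have "(1 - t) * (?F ?z + ?s ?z * (a - ?z)) + t * (?F ?z + ?s ?z * (b - ?z)) = ?F ?z"
      by (simp add: algebra_simps)
    finally show ?thesis .
  next
    case False
    then have "a \<ge> 0" "b \<ge> 0" "?z \<le> 0" using ab by (auto simp: edom_phibar[OF f])
    moreover from this have "(1 - t) * a \<ge> 0" "t * b \<ge> 0" using t by auto
    ultimately have "(1 - t) * a = 0" "t * b = 0" unfolding real_scaleR_def by linarith+
    then have "a = 0" "b = 0" using t by auto
    then show ?thesis by (simp add: algebra_simps)
  qed
qed

lemma phibar_on_edom:
  assumes f: "f \<in> Gamma0" and "lam \<in> edom (phibar f x)"
  shows "phibar f x lam = ereal (phi_real f x lam)"
  using assms(2) by (intro phibar_eq_phi_real[OF f]) (auto simp: edom_phibar[OF f] split: if_splits)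

lemma eepi_phibar:
  assumes f: "f \<in> Gamma0"
  shows "eepi (phibar f x) = epigraph (edom (phibar f x)) (phi_real f x)"
proof -
  have "phibar f x lam \<le> ereal r \<longleftrightarrow> lam \<in> edom (phibar f x) \<and> phi_real f x lam \<le> r" for lam r
    using phibar_on_edom[OF f, of lam x] not_edom[of lam "phibar f x"]
    by (cases "lam \<in> edom (phibar f x)") auto
  then show ?thesis by (auto simp: eepi_def epigraph_def)
qed

lemma has_ereal_deriv_phibar:
  assumes f: "f \<in> Gamma0" and lam: "lam > 0 \<or> proj_cl_dom f x \<in> edom f"
  shows "has_ereal_deriv (phibar f x) (ereal (phi_slope f x lam)) lam"
proof -
  have "\<forall>\<^sub>F t in nhds lam. t > 0 \<or> proj_cl_dom f x \<in> edom f"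
    using lam eventually_nhds_in_open[OF open_greaterThan, of lam 0] by (auto elim: eventually_mono)
  then have ev: "\<forall>\<^sub>F t in nhds lam. phibar f x t = ereal (phi_real f x t)"
    by (rule eventually_mono) (auto intro: phibar_eq_phi_real[OF f])
  then have "\<forall>\<^sub>F t in nhds lam. \<bar>phibar f x t\<bar> \<noteq> \<infinity>" by (rule eventually_mono) auto
  moreover from ev have "\<forall>\<^sub>F t in nhds lam. real_of_ereal (phibar f x t) = phi_real f x t"
    by (rule eventually_mono) auto
  then have "((\<lambda>t. real_of_ereal (phibar f x t)) has_real_derivative phi_slope f x lam) (at lam)"
    using DERIV_phi_real[OF f lam] by (subst DERIV_cong_ev[OF refl _ refl])
  ultimately show ?thesis by (simp add: has_ereal_deriv_def)
qed

lemma uminus_value_eq_phi_slope: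
  assumes f: "f \<in> Gamma0"
  shows "lam > 0 \<Longrightarrow> - f (prox lam f x) = ereal (phi_slope f x lam)"
    and "lam \<le> 0 \<Longrightarrow> proj_cl_dom f x \<in> edom f \<Longrightarrow> - f (proj_cl_dom f x) = ereal (phi_slope f x lam)"
proof -
  have val: "- f u = ereal (- real_of_ereal (f u))" if u: "u \<in> edom f" for u
    by (subst Gamma0_real[OF f u]) simp
  show "lam > 0 \<Longrightarrow> - f (prox lam f x) = ereal (phi_slope f x lam)"
    unfolding phi_slope_def by (simp only: if_True val[OF prox_in_edom[OF f]])
  show "lam \<le> 0 \<Longrightarrow> proj_cl_dom f x \<in> edom f \<Longrightarrow> - f (proj_cl_dom f x) = ereal (phi_slope f x lam)"
    unfolding phi_slope_def by (simp only: val if_False flip: not_less)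
qed

text \<open>A subgradient \<open>v\<close> of \<open>f\<close> at \<open>x\<close> bounds \<open>norm (x - prox t f x) / t\<close> by \<open>norm v\<close> uniformly in \<open>t > 0\<close>, and \<open>x\<close> is
  then its own projection.\<close>
lemma phi_slope_lipschitz:
  assumes f: "f \<in> Gamma0" and v: "v \<in> subdiff f x"
  shows "((norm v)\<^sup>2)-lipschitz_on UNIV (phi_slope f x)"
proof -
  have xd: "x \<in> edom f"
  proof (rule ccontr)
    assume "x \<notin> edom f"
    obtain u where u: "u \<in> edom f" using edom_nonempty[OF f] by blast
    have "f x + ereal (v \<bullet> (u - x)) \<le> f u" using v by (simp add: subdiff_def)
    then show False using u not_edom[OF \<open>x \<notin> edom f\<close>] by (simp add: edom_def)
  qed
  then have p: "proj_cl_dom f x = x" using closure_subset by (intro closest_point_self) auto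
  have sub: "real_of_ereal (f x) + v \<bullet> (u - x) \<le> real_of_ereal (f u)" if u: "u \<in> edom f" for u
  proof -
    have "f x + ereal (v \<bullet> (u - x)) \<le> f u" using v by (simp add: subdiff_def)
    then show ?thesis
      using Gamma0_real[OF f u] Gamma0_real[OF f xd] by (metis ereal_less_eq(3) plus_ereal.simps(1))
  qed
  note quot = norm_prox_quotient_le_subgradient[OF f _ xd sub]
  have main: "\<bar>phi_slope f x a - phi_slope f x b\<bar> \<le> (norm v)\<^sup>2 * \<bar>a - b\<bar>" if "a \<le> b" for a b
  proof -
    consider "b \<le> 0" | "a > 0" | "a \<le> 0" "b > 0" by linarith
    then show ?thesis
    proof cases
      case 1
      then show ?thesis using that by (simp add: phi_slope_def)
    next
      case 2
      then show ?thesis using that prox_value_diff_le[OF f, of a b x, OF _ _ quot quot]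
        by (simp add: phi_slope_def abs_minus_commute)
    next
      case 3
      let ?q = "prox b f x"
      have n: "norm (x - ?q) \<le> b * norm v" using quot[OF 3(2)] 3 by (simp add: field_simps)
      have "real_of_ereal (f x) - real_of_ereal (f ?q) \<le> v \<bullet> (x - ?q)"
        using sub[OF prox_in_edom[OF f 3(2), of x]] by (simp add: inner_diff_right)
      also have "\<dots> \<le> norm v * norm (x - ?q)" by (rule norm_cauchy_schwarz)
      also have "\<dots> \<le> norm v * (b * norm v)" using n by (intro mult_left_mono) auto
      also have "\<dots> = (norm v)\<^sup>2 * b" by (simp add: power2_eq_square)
      also have "\<dots> \<le> (norm v)\<^sup>2 * \<bar>a - b\<bar>" using 3 by (intro mult_left_mono) auto
      finally have "real_of_ereal (f x) - real_of_ereal (f ?q) \<le> (norm v)\<^sup>2 * \<bar>a - b\<bar>" .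
      moreover have "real_of_ereal (f ?q) \<le> real_of_ereal (f x)"
        using prox_subgradient[OF f 3(2) xd, of x] 3
        by (smt (verit) divide_nonneg_pos inner_ge_zero)
      ultimately show ?thesis using 3 p by (simp add: phi_slope_def)
    qed
  qed
  show ?thesis
  proof (rule lipschitz_onI)
    fix a b :: real
    show "dist (phi_slope f x a) (phi_slope f x b) \<le> (norm v)\<^sup>2 * dist a b"
      using main[of a b] main[of b a] by (cases "a \<le> b") (auto simp: dist_real_def abs_minus_commute)
  qed simp
qed

section \<open>The subdifferential\<close>

lemma subdiff_phibar_pos:
  assumes f: "f \<in> Gamma0" and lam: "lam > 0"
  shows "subdiff (phibar f x) lam = {phi_slope f x lam}"
proof (intro equalityI subsetI)
  fix v assume v: "v \<in> subdiff (phibar f x) lam"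
  have "((\<lambda>t. phi_real f x t - v * t) has_real_derivative phi_slope f x lam - v) (at lam)"
    by (auto intro!: derivative_eq_intros DERIV_phi_real[OF f] simp: lam)
  moreover have "\<forall>t. \<bar>lam - t\<bar> < lam \<longrightarrow> phi_real f x lam - v * lam \<le> phi_real f x t - v * t"
  proof (intro allI impI)
    fix t assume "\<bar>lam - t\<bar> < lam"
    then have t: "t > 0" by (simp add: abs_less_iff)
    have "phibar f x lam + ereal (inner v (t - lam)) \<le> phibar f x t" using v by (simp add: subdiff_def)
    then show "phi_real f x lam - v * lam \<le> phi_real f x t - v * t"
      using t lam by (simp add: phibar_eq_phi_real[OF f] algebra_simps)
  qed
  ultimately have "phi_slope f x lam - v = 0" using DERIV_local_min[OF _ lam] by blast
  then show "v \<in> {phi_slope f x lam}" by simp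
next
  fix v assume "v \<in> {phi_slope f x lam}"
  then have v: "v = phi_slope f x lam" by simp
  have "phibar f x lam + ereal (inner v (t - lam)) \<le> phibar f x t" for t
  proof (cases "t \<in> edom (phibar f x)")
    case True
    then have "t \<ge> 0 \<or> proj_cl_dom f x \<in> edom f" by (auto simp: edom_phibar[OF f] split: if_splits)
    then show ?thesis using phi_real_subgradient_prox[OF f lam, of t x] lam v
      by (simp add: phibar_eq_phi_real[OF f])
  qed (simp add: not_edom)
  then show "v \<in> subdiff (phibar f x) lam" by (simp add: subdiff_def)
qed

lemma subdiff_phibar_nonpos:
  assumes f: "f \<in> Gamma0" and p: "proj_cl_dom f x \<notin> edom f" and lam: "lam \<le> 0"
  shows "subdiff (phibar f x) lam = {}"
proof (rule ccontr)
  assume "subdiff (phibar f x) lam \<noteq> {}"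
  then obtain v where v: "\<And>t. phibar f x lam + ereal (inner v (t - lam)) \<le> phibar f x t"
    by (auto simp: subdiff_def)
  show False
  proof (cases "lam = 0")
    case False
    then show False using v[of 0] phibar_infty[OF _ p, of lam] lam by (simp add: phibar_eq_phi_real[OF f])
  next
    case True
    \<comment> \<open>A subgradient at \<open>0\<close> bounds \<open>f\<close> at the proximal points, and these points tend to the projection.\<close>
    have bound: "f (prox t f x) \<le> ereal (- v)" if t: "t > 0" for t
    proof -
      have "phi_real f x 0 + v * t \<le> phi_real f x t"
        using v[of t] True t by (simp add: phibar_eq_phi_real[OF f])
      moreover have "(norm (x - proj_cl_dom f x))\<^sup>2 \<le> (norm (x - prox t f x))\<^sup>2"
        using norm_proj_cl_dom_le[OF prox_in_edom[OF f t, of x], of x] by (simp add: power_mono)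
      moreover have "phi_real f x t =
          - (t * real_of_ereal (f (prox t f x))) - (norm (x - prox t f x))\<^sup>2 / 2"
        "phi_real f x 0 = - (norm (x - proj_cl_dom f x))\<^sup>2 / 2"
        using t by (simp_all add: phi_real_def)
      ultimately have "v * t \<le> - (t * real_of_ereal (f (prox t f x)))" by linarith
      then have "t * real_of_ereal (f (prox t f x)) \<le> t * (- v)" by (simp add: mult.commute)
      then have "real_of_ereal (f (prox t f x)) \<le> - v" using t by (simp only: mult_le_cancel_left_pos)
      then show ?thesis using Gamma0_real[OF f prox_in_edom[OF f t, of x]] by (metis ereal_less_eq(3))
    qed
    have "proj_cl_dom f x \<in> {u. ereal (- v) < f u}" using p by (simp add: not_edom)
    then have "\<forall>\<^sub>F t in at_right 0. ereal (- v) < f (prox t f x)"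
      using topological_tendstoD[OF tendsto_prox_0[OF f] Gamma0_lsc[OF f]] by force
    then have "\<forall>\<^sub>F t in at_right (0::real). False"
      using eventually_at_right_less[of "0::real"] by eventually_elim (use bound in \<open>auto simp: not_less[symmetric]\<close>)
    then show False by (simp add: trivial_limit_at_right_real)
  qed
qed

section \<open>The function of the proximal parameter\<close>

theorem corollary12:
  fixes f :: "'a::euclidean_space \<Rightarrow> ereal" and xbar :: 'a
  assumes "f \<in> Gamma0"
  shows
    "(proper_fun (phibar f xbar) \<and> convex_fun (phibar f xbar) \<and>
      closed_fun (phibar f xbar) \<and> continuous_on (edom (phibar f xbar)) (phibar f xbar) \<and>
      (\<forall>lam>0. has_ereal_deriv (phibar f xbar) (- f (prox lam f xbar)) lam) \<and>
      continuous_on {0<..} (\<lambda>lam. real_of_ereal (- f (prox lam f xbar))) \<and>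
      locally_lipschitz_on {0<..} (\<lambda>lam. real_of_ereal (- f (prox lam f xbar))))
     \<and>
     (let D = (\<lambda>lam. if lam > 0 then - f (prox lam f xbar) else - f (proj_cl_dom f xbar)) in
       (xbar \<in> edom f \<longrightarrow>
          (\<forall>lam. has_ereal_deriv (phibar f xbar) (D lam) lam) \<and>
          continuous_on UNIV (\<lambda>lam. real_of_ereal (D lam))) \<and>
       (xbar \<in> dom_subdiff f \<longrightarrow>
          locally_lipschitz_on UNIV (\<lambda>lam. real_of_ereal (D lam))))
     \<and>
     (proj_cl_dom f xbar \<notin> edom f \<longrightarrow>
        edom (phibar f xbar) = {0..} \<and>
        (\<forall>lam. ereal ` subdiff (phibar f xbar) lam =
           (if lam > 0 then {- f (prox lam f xbar)} else {})))"
proof -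
  note f = assms
  let ?E = "edom (phibar f xbar)" and ?F = "phi_real f xbar" and ?s = "phi_slope f xbar"
  have proper: "proper_fun (phibar f xbar)"
  proof -
    have "phibar f xbar lam \<noteq> - \<infinity>" for lam
      using phibar_on_edom[OF f, of lam xbar] not_edom[of lam "phibar f xbar"]
      by (cases "lam \<in> ?E") auto
    moreover have "phibar f xbar 0 \<noteq> \<infinity>" by (simp add: phibar_eq_phi_real[OF f])
    ultimately show ?thesis unfolding proper_fun_def by blast
  qed
  have convex: "convex_fun (phibar f xbar)"
    using convex_on_phi_real[OF f, of xbar]
    by (simp add: convex_fun_def eepi_phibar[OF f] convex_epigraph convex_on_imp_convex)
  have closed: "closed_fun (phibar f xbar)"
  proof -
    have "closed ?E" by (simp add: edom_phibar[OF f])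
    then have "closed {z \<in> ?E \<times> UNIV. ?F (fst z) \<le> snd z}"
      by (intro continuous_on_closed_Collect_le closed_Times continuous_on_compose2[OF continuous_on_phi_real[OF f]]
          continuous_on_fst continuous_on_snd continuous_on_id) auto
    moreover have "epigraph ?E ?F = {z \<in> ?E \<times> UNIV. ?F (fst z) \<le> snd z}"
      by (auto simp: epigraph_def)
    ultimately show ?thesis by (simp add: closed_fun_def eepi_phibar[OF f])
  qed
  have cont: "continuous_on ?E (phibar f xbar)"
    using continuous_on_compose2[OF continuous_on_ereal[OF continuous_on_id] continuous_on_phi_real[OF f, of xbar]]
    by (auto simp: phibar_on_edom[OF f] cong: continuous_on_cong)
  have s_pos: "real_of_ereal (- f (prox lam f xbar)) = ?s lam" if "lam > 0" for lam
    using that by (simp add: phi_slope_def)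
  have deriv: "\<forall>lam>0. has_ereal_deriv (phibar f xbar) (- f (prox lam f xbar)) lam"
    using has_ereal_deriv_phibar[OF f] by (auto simp: uminus_value_eq_phi_slope[OF f])
  have "continuous_on {0<..} ?s"
    by (intro continuous_at_imp_continuous_on ballI isCont_phi_slope_pos[OF f]) auto
  then have cont_pos: "continuous_on {0<..} (\<lambda>lam. real_of_ereal (- f (prox lam f xbar)))"
    by (rule continuous_on_eq) (use s_pos in auto)
  have lip_pos: "locally_lipschitz_on {0<..} (\<lambda>lam. real_of_ereal (- f (prox lam f xbar)))"
    unfolding locally_lipschitz_on_def
  proof (intro ballI exI conjI)
    fix lam :: real assume "lam \<in> {0<..}"
    then have lam: "lam > 0" by simp
    then show "lam / 2 > 0" by simp
    have "((3 * norm (xbar - prox lam f xbar) / lam)\<^sup>2)-lipschitz_on (cball lam (lam / 2) \<inter> {0<..}) ?s"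
      using phi_slope_lipschitz_near[OF f lam] by (rule lipschitz_on_subset) auto
    then show "((3 * norm (xbar - prox lam f xbar) / lam)\<^sup>2)-lipschitz_on (cball lam (lam / 2) \<inter> {0<..})
        (\<lambda>lam. real_of_ereal (- f (prox lam f xbar)))"
      by (rule lipschitz_on_transform) (use s_pos in auto)
  qed
  define D where "D = (\<lambda>lam. if lam > 0 then - f (prox lam f xbar) else - f (proj_cl_dom f xbar))"
  have D: "real_of_ereal (D lam) = ?s lam" for lam by (simp add: D_def phi_slope_def)
  have b1: "(\<forall>lam. has_ereal_deriv (phibar f xbar) (D lam) lam) \<and>
      continuous_on UNIV (\<lambda>lam. real_of_ereal (D lam))" if "xbar \<in> edom f"
  proof -
    have p: "proj_cl_dom f xbar \<in> edom f"
      using that closure_subset[of "edom f"] by (metis closest_point_self subsetD)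
    have "D lam = ereal (?s lam)" for lam
      using p by (simp add: D_def uminus_value_eq_phi_slope[OF f])
    then show ?thesis using has_ereal_deriv_phibar[OF f] isCont_phi_slope[OF f p] p
      by (auto simp: continuous_at_imp_continuous_on)
  qed
  have b2: "locally_lipschitz_on UNIV (\<lambda>lam. real_of_ereal (D lam))" if "xbar \<in> dom_subdiff f"
  proof -
    obtain v where v: "v \<in> subdiff f xbar" using \<open>xbar \<in> dom_subdiff f\<close> by (auto simp: dom_subdiff_def)
    have "((norm v)\<^sup>2)-lipschitz_on (cball lam 1 \<inter> UNIV) ?s" for lam
      using phi_slope_lipschitz[OF f v] by (rule lipschitz_on_subset) auto
    then show ?thesis unfolding locally_lipschitz_on_def D by (metis zero_less_one)
  qed
  have c: "edom (phibar f xbar) = {0..} \<and> (\<forall>lam. ereal ` subdiff (phibar f xbar) lam =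
           (if lam > 0 then {- f (prox lam f xbar)} else {}))" if p: "proj_cl_dom f xbar \<notin> edom f"
    using p subdiff_phibar_nonpos[OF f p]
    by (simp add: edom_phibar[OF f] subdiff_phibar_pos[OF f] uminus_value_eq_phi_slope[OF f])
  show ?thesis
    unfolding Let_def D_def[symmetric]
    using proper convex closed cont deriv cont_pos lip_pos b1 b2 c by blast
qed

end
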